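(* Let $P$ be a Borel probability measure on $\mathbb{R}$ with cumulative distribution function $F$, let $\varepsilon>0$, and fix $a\in\mathbb{R}$. Consider the programme $$\min_{Q\ll P}\bigl\{Q((-\infty,a]) : D_{\mathrm{KL}}(Q\Vert P)\le\varepsilon\bigr\},\qquad ( * )$$ where $Q$ ranges over Borel probability measures on $\mathbb{R}$. For $\lambda>0$ let $Q_{\lambda,a}$ be the probability measure given by $$\frac{\mathrm dQ_{\lambda,a}}{\mathrm dP}(x)=\frac{\exp\bigl[-I_{\{x\le a\}}/\lambda\bigr]}{Z(\lambda,a)},\qquad Z(\lambda,a)=1-\bigl(1-e^{-1/\lambda}\bigr)F(a),$$ and let $G_{\lambda,a}$ be its cumulative distribution function. Then: (i) There exists a unique solution of $( * )$, and it is the exponentially tilted measure $Q_{\lambda,a}$ for some $\lambda>0$ (the Lagrange multiplier of the constraint $D_{\mathrm{KL}}(Q\Vert P)\le\varepsilon$). (ii) Under $Q_{\lambda,a}$, $$G_{\lambda,a}(a)=\frac{e^{-1/\lambda}F(a)}{Z(\lambda,a)},\qquad D_{\mathrm{KL}}\bigl(Q_{\lambda,a}\Vert P\bigr)=-\log Z(\lambda,a)-\frac{1}{\lambda}\,G_{\lambda,a}(a).$$ (iii) For each fixed $a$ the map $\lambda\mapsto D_{\mathrm{KL}}(Q_{\lambda,a}\Vert P)$ is continuous and strictly decreasing on $(0,\infty)$. Hence, for every $\varepsilon>0$ there is a unique $\lambda(a)\in(0,\infty)$ such that $D_{\mathrm{KL}}(Q_{\lambda(a),a}\Vert P)=\v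arepsilon$.
   Context: For $Q\ll P$, the Kullback–Leibler divergence is $D_{\mathrm{KL}}(Q\Vert P)=\int\log\frac{\mathrm dQ}{\mathrm dP}\,\mathrm dQ$. $I_{\{x\le a\}}$ is the indicator function of $(-\infty,a]$. The cumulative distribution function of a measure $Q$ is $x\mapsto Q((-\infty,x])$. The Lagrangian of the programme $( * )$ is $L(Q;\lambda)=Q((-\infty,a])+\lambda\bigl(D_{\mathrm{KL}}(Q\Vert P)-\varepsilon\bigr)$.
   Formalization: Uniqueness, the tilted form and the multiplier in (i) are stated for 0<F(a)<1 and ε<-log(1-F(a)); strict decrease in (iii) for 0<F(a)<1; unique λ(a) for ε<-log(1-F(a)). Otherwise the tilted form, the decrease and λ(a) fail. Existence, (ii) and continuity are unconditional. *)

theory Defs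
  imports "HOL-Probability.Probability"
begin

text \<open>
  The library's \<^const>\<open>KL_divergence\<close> is a Bochner integral, so it silently returns 0 when the
  log-density is not integrable, i.e. it would make measures of infinite divergence feasible in
  the programme below. For probability measures \<open>Q \<lless> P\<close> the negative part of
  \<open>log (dQ/dP)\<close> is always \<open>Q\<close>-integrable (as \<open>x log x\<close> is bounded below), so
  non-integrability means exactly that the divergence is infinite. The value is only meaningful
  for \<open>Q \<lless> P\<close>. The base \<open>exp 1\<close> gives natural logarithms, and \<open>Q\<close> is the second
  argument of \<^const>\<open>KL_divergence\<close>.
\<close>
definition DKL :: "real measure \<Rightarrow> real measure \<Rightarrow> ereal" where
  "DKL Q P = (if integrable Q (entropy_density (exp 1) P Q)
              then ereal (KL_divergence (exp 1) P Q) else \<infinity>)"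

definition dominated :: "real measure \<Rightarrow> real measure \<Rightarrow> bool" where
  "dominated P Q \<longleftrightarrow> real_distribution Q \<and> absolutely_continuous P Q"

definition feasible :: "real measure \<Rightarrow> real \<Rightarrow> real measure \<Rightarrow> bool" where
  "feasible P \<epsilon> Q \<longleftrightarrow> dominated P Q \<and> DKL Q P \<le> ereal \<epsilon>"

definition is_solution :: "real measure \<Rightarrow> real \<Rightarrow> real \<Rightarrow> real measure \<Rightarrow> bool" where
  "is_solution P \<epsilon> a Q \<longleftrightarrow> is_arg_min (\<lambda>Q. measure Q {..a}) (feasible P \<epsilon>) Q"

definition lagrangian :: "real measure \<Rightarrow> real \<Rightarrow> real \<Rightarrow> real measure \<Rightarrow> real \<Rightarrow> ereal" where
  "lagrangian P \<epsilon> a Q lam = ereal (measure Q {..a}) + ereal lam * (DKL Q P - ereal \<epsilon>)"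

text \<open>
  Karush--Kuhn--Tucker multiplier of the divergence constraint at \<open>Q\<close>: primal and dual
  feasibility, minimisation of the Lagrangian over all \<open>Q' \<lless> P\<close> (without the divergence
  constraint), and complementary slackness.
\<close>
definition lagrange_multiplier :: "real measure \<Rightarrow> real \<Rightarrow> real \<Rightarrow> real measure \<Rightarrow> real \<Rightarrow> bool" where
  "lagrange_multiplier P \<epsilon> a Q lam \<longleftrightarrow>
     feasible P \<epsilon> Q \<and> 0 \<le> lam \<and>
     is_arg_min (\<lambda>Q'. lagrangian P \<epsilon> a Q' lam) (dominated P) Q \<and>
     ereal lam * (DKL Q P - ereal \<epsilon>) = 0"

definition tilt_Z :: "real measure \<Rightarrow> real \<Rightarrow> real \<Rightarrow> real" where
  "tilt_Z P lam a = 1 - (1 - exp (- 1 / lam)) * cdf P a"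

definition tilted :: "real measure \<Rightarrow> real \<Rightarrow> real \<Rightarrow> real measure" where
  "tilted P lam a = density P (\<lambda>x. ennreal (exp (- indicator {..a} x / lam) / tilt_Z P lam a))"

lemma tilt_Z_pos:
  assumes "real_distribution P" and "lam > 0"
  shows "tilt_Z P lam a > 0"
proof -
  interpret real_distribution P by fact
  have F: "0 \<le> cdf P a" "cdf P a \<le> 1" by (simp_all add: cdf_nonneg cdf_bounded_prob)
  have e: "0 < exp (- 1 / lam)" "exp (- 1 / lam) < 1" using assms(2) by auto
  have "(1 - exp (- 1 / lam)) * cdf P a \<le> (1 - exp (- 1 / lam)) * 1"
    by (intro mult_left_mono) (use F e in auto)
  also have "\<dots> < 1" using e by simp
  finally show ?thesis unfolding tilt_Z_def by simp
qed

lemma real_distribution_tilted: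
  assumes "real_distribution P" and "lam > 0"
  shows "real_distribution (tilted P lam a)"
proof -
  interpret real_distribution P by fact
  note Zp = tilt_Z_pos[OF assms, of a]
  have split: "exp (- indicator {..a} x / lam) = 1 - (1 - exp (- 1 / lam)) * indicator {..a} x"
    for x :: real by (auto simp: indicator_def)
  have int: "integrable P (\<lambda>x. exp (- indicator {..a} x / lam) / tilt_Z P lam a)"
    unfolding split by (intro integrable_divide Bochner_Integration.integrable_diff
        integrable_mult_right) (auto simp: emeasure_eq_measure)
  have "(\<integral>x. exp (- indicator {..a} x / lam) / tilt_Z P lam a \<partial>P) = 1"
    using Zp unfolding split
    by (subst integral_divide_zero, subst Bochner_Integration.integral_diff)
       (auto simp: tilt_Z_def cdf_def emeasure_eq_measure prob_space[unfolded space_eq_univ])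
  then have "emeasure (tilted P lam a) (space (tilted P lam a)) = 1"
    using Zp int unfolding tilted_def
    by (subst emeasure_density) (auto simp: nn_integral_eq_integral)
  then show ?thesis
    by (auto simp: real_distribution_def real_distribution_axioms_def tilted_def intro: prob_spaceI)
qed

end

theory Submission
  imports Defs "HOL-Real_Asymp.Real_Asymp"
begin

text \<open>
  Write \<open>A = {..a}\<close>, \<open>F = cdf P a\<close>, and let \<open>T\<close> be the tilted measure with parameter \<open>lam\<close>.
  The logarithm of \<open>dT/dP\<close> is the affine function \<open>- indicator A / lam - ln Z\<close> of the indicator of
  \<open>A\<close>, so splitting \<open>dQ/dP = (dQ/dT) (dT/dP)\<close> under the logarithm gives
  \<open>DKL Q P = DKL Q T - ln Z - measure Q A / lam\<close>
  for every \<open>Q\<close> dominated by \<open>P\<close> (\<open>DKL_split_tilted\<close>). With \<open>Q = T\<close> this is the formula for the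
  divergence of \<open>T\<close>. Multiplied by \<open>lam\<close>, it says that the Lagrangian at \<open>Q\<close> exceeds the one at
  \<open>T\<close> by exactly \<open>lam * DKL Q T\<close> (\<open>lagrangian_gap\<close>), which by the Gibbs inequality
  (\<open>DKL_gibbs\<close>) is nonnegative and vanishes only at \<open>Q = T\<close>. Hence \<open>T\<close> is the only minimiser
  of its Lagrangian, and as soon as the constraint is active at \<open>T\<close> it is the only solution of the
  programme, with multiplier \<open>lam\<close> (\<open>tilted_optimal\<close>).

  Let \<open>0 < F < 1\<close>. To make the constraint active, substitute \<open>u = exp (- 1 / lam)\<close>, which
  increases from 0 to 1 as \<open>lam\<close> runs through the positive reals. The divergence becomes an
  elementary function of \<open>u\<close> with derivative \<open>F (1 - F) ln u / Z^2 < 0\<close>, falling from the limit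
  \<open>- ln (1 - F)\<close> at \<open>u = 0\<close> to 0 at \<open>u = 1\<close>; the intermediate value theorem then yields a unique
  parameter for each level strictly in between.

  The upper limit \<open>- ln (1 - F)\<close> is the divergence of \<open>P\<close> conditioned on the complement of \<open>A\<close>.
  If \<open>\<epsilon>\<close> is at least that large, the conditioned measure is feasible and gives \<open>A\<close> mass 0, so
  it is a solution; if \<open>F\<close> is 0 or 1, then \<open>P\<close> itself is one.
\<close>

section \<open>Relative entropy and change of reference measure\<close>

lemma entropy_density_density:
  fixes f :: "'a \<Rightarrow> real"
  assumes "sigma_finite_measure M" and [measurable]: "f \<in> borel_measurable M"
    and nonneg: "\<And>x. 0 \<le> f x"
  shows "AE x in density M f. entropy_density (exp 1) M (density M f) x = ln (f x)"
proof -
  interpret sigma_finite_measure M by fact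
  have "AE x in M. ennreal (f x) = RN_deriv M (density M f) x"
    by (rule RN_deriv_unique) auto
  then have "AE x in M. entropy_density (exp 1) M (density M f) x = ln (f x)"
  proof eventually_elim
    case (elim x)
    then have "enn2real (RN_deriv M (density M f) x) = f x"
      by (metis enn2real_ennreal nonneg)
    then show ?case by (simp add: entropy_density_def log_def)
  qed
  then show ?thesis
    by (subst AE_density) auto
qed

text \<open>
  If \<open>q\<close> is the density of \<open>Q\<close> with respect to \<open>P\<close>, then \<open>q / r\<close> is its density with respect to
  \<open>r P\<close>. The logarithm of the quotient splits only where \<open>q > 0\<close>, which is almost everywhere for
  \<open>Q\<close> but perhaps not for \<open>P\<close>.
\<close>

lemma entropy_density_chain:
  fixes r :: "'a \<Rightarrow> real"
  assumes "sigma_finite_measure P" "finite_measure Q"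
    and ac: "absolutely_continuous P Q" "sets Q = sets P"
    and r [measurable]: "r \<in> borel_measurable P" and r_pos: "\<And>x. 0 < r x"
  shows "AE x in Q. entropy_density (exp 1) P Q x
           = entropy_density (exp 1) (density P r) Q x + ln (r x)"
proof -
  interpret sigma_finite_measure P by fact
  from real_RN_deriv[OF assms(2) ac] obtain q where q:
      "q \<in> borel_measurable P" "AE x in P. RN_deriv P Q x = ennreal (q x)"
      "AE x in Q. 0 < q x" "\<And>x. 0 \<le> q x"
    by this auto
  note [measurable] = q(1)
  have "Q = density P (RN_deriv P Q)"
    using ac by (rule density_RN_deriv[symmetric])
  also have "\<dots> = density P q"
    using q by (auto intro!: density_cong)
  finally have Q: "Q = density P q" .
  have R: "sigma_finite_measure (density P r)"
    by (subst sigma_finite_iff_density_finite) auto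
  have QR: "Q = density (density P r) (\<lambda>x. q x / r x)"
    unfolding Q using r_pos q(4)
    by (subst density_density_divide) (auto simp: less_imp_le less_imp_neq[THEN not_sym])
  have "AE x in Q. entropy_density (exp 1) P Q x = ln (q x)"
    unfolding Q by (rule entropy_density_density) (use q assms in auto)
  moreover have "AE x in Q. entropy_density (exp 1) (density P r) Q x = ln (q x / r x)"
    unfolding QR by (rule entropy_density_density)
      (use q R r_pos in \<open>auto simp: less_imp_le\<close>)
  ultimately show ?thesis
    using q(3)
  proof eventually_elim
    case (elim x)
    then show ?case using r_pos[of x] by (simp add: ln_div)
  qed
qed

text \<open>
  Integrating the pointwise chain rule. Since \<open>ln r\<close> is integrable, the two entropy densities are
  integrable together, so the identity also covers infinite divergence.
\<close>

lemma DKL_chain: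
  fixes r :: "real \<Rightarrow> real"
  assumes "sigma_finite_measure P" "finite_measure Q"
    and ac: "absolutely_continuous P Q" "sets Q = sets P"
    and r [measurable]: "r \<in> borel_measurable P" and r_pos: "\<And>x. 0 < r x"
    and int: "integrable Q (\<lambda>x. ln (r x))"
  shows "DKL Q P = DKL Q (density P r) + ereal (\<integral>x. ln (r x) \<partial>Q)"
proof -
  let ?R = "density P r"
  note [measurable_cong] = ac(2)
  note chain = entropy_density_chain[OF assms(1-6)]
  have [measurable]: "entropy_density (exp 1) P Q \<in> borel_measurable Q"
    "entropy_density (exp 1) ?R Q \<in> borel_measurable Q"
    using measurable_entropy_density[of "exp 1" P Q] measurable_entropy_density[of "exp 1" ?R Q]
    by (simp_all add: measurable_def ac(2) sets_eq_imp_space_eq[OF ac(2)])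
  have iff: "integrable Q (entropy_density (exp 1) P Q)
      \<longleftrightarrow> integrable Q (entropy_density (exp 1) ?R Q)" (is "?A \<longleftrightarrow> ?B")
  proof -
    have "?A \<longleftrightarrow> integrable Q (\<lambda>x. entropy_density (exp 1) ?R Q x + ln (r x))"
      by (rule integrable_cong_AE) (use chain in auto)
    also have "\<dots> \<longleftrightarrow> ?B"
    proof
      assume "integrable Q (\<lambda>x. entropy_density (exp 1) ?R Q x + ln (r x))"
      from Bochner_Integration.integrable_diff[OF this int] show ?B by simp
    qed (use int in auto)
    finally show ?thesis .
  qed
  have "KL_divergence (exp 1) P Q = KL_divergence (exp 1) ?R Q + (\<integral>x. ln (r x) \<partial>Q)" if ?B
  proof -
    have "KL_divergence (exp 1) P Q = (\<integral>x. entropy_density (exp 1) ?R Q x + ln (r x) \<partial>Q)"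
      unfolding KL_divergence_def by (rule integral_cong_AE) (use chain in auto)
    then show ?thesis
      using that int by (simp add: KL_divergence_def)
  qed
  then show ?thesis using iff by (simp add: DKL_def)
qed

lemma DKL_refl:
  assumes "real_distribution P"
  shows "DKL P P = 0"
proof -
  interpret real_distribution P by fact
  have "AE x in P. entropy_density (exp 1) P P x = 0"
    using entropy_density_density[of P "\<lambda>_. 1"] sigma_finite_measure_axioms
    by (simp only: ennreal_1 density_1) simp
  then have "integrable P (entropy_density (exp 1) P P)"
    by (subst integrable_cong_AE[of _ _ "\<lambda>_. 0"]) auto
  then show ?thesis
    by (simp add: DKL_def KL_same_eq_0)
qed

text \<open>
  The Gibbs inequality and its equality case, transferred from \<^const>\<open>KL_divergence\<close>. The
  infinite value of \<^const>\<open>DKL\<close> matters for the equality case: when the entropy density is not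
  integrable, the Bochner integral is 0 although the measures differ.
\<close>

lemma DKL_gibbs:
  assumes "real_distribution R" and "dominated R Q"
  shows "0 \<le> DKL Q R" and "DKL Q R = 0 \<longleftrightarrow> Q = R"
proof -
  interpret R: real_distribution R by fact
  interpret R: information_space R "exp 1" by standard simp
  interpret Q: real_distribution Q using assms(2) by (simp add: dominated_def)
  have ac: "absolutely_continuous R Q" "sets Q = sets R"
    using assms(2) by (auto simp: dominated_def)
  show eq: "DKL Q R = 0 \<longleftrightarrow> Q = R"
    using R.KL_eq_0_iff_eq_ac[OF Q.prob_space_axioms ac] DKL_refl[OF assms(1)]
    by (auto simp: DKL_def zero_ereal_def)
  show "0 \<le> DKL Q R"
  proof (cases "integrable Q (entropy_density (exp 1) R Q)")
    case True
    from R.real_RN_deriv[OF Q.finite_measure_axioms ac] obtain q where q: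
        "q \<in> borel_measurable R" "AE x in R. RN_deriv R Q x = ennreal (q x)"
        "\<And>x. 0 \<le> q x"
      by this auto
    note [measurable] = q(1)
    have "Q = density R (RN_deriv R Q)"
      using ac by (rule R.density_RN_deriv[symmetric])
    also have "\<dots> = density R q"
      using q by (auto intro!: density_cong)
    finally have Q: "Q = density R q" .
    have [measurable]: "entropy_density (exp 1) R Q \<in> borel_measurable R"
      by simp
    have "AE x in Q. entropy_density (exp 1) R Q x = ln (q x)"
      unfolding Q by (rule entropy_density_density) (use q R.sigma_finite_measure_axioms in auto)
    then have "integrable Q (\<lambda>x. ln (q x))"
      using True by (subst integrable_cong_AE[of _ _ "entropy_density (exp 1) R Q"])
        (auto simp: ac(2) cong: measurable_cong_sets)
    then have "integrable R (\<lambda>x. q x * log (exp 1) (q x))"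
      unfolding Q using q by (subst (asm) integrable_real_density) (auto simp: log_def)
    then have "0 \<le> KL_divergence (exp 1) R Q"
      unfolding Q using q Q.prob_space_axioms by (intro R.KL_nonneg) (auto simp: Q[symmetric])
    then show ?thesis by (simp add: DKL_def)
  qed (simp add: DKL_def)
qed

section \<open>The exponentially tilted measure\<close>

lemma absolutely_continuous_density_pos:
  fixes r :: "'a \<Rightarrow> real"
  assumes "r \<in> borel_measurable P" "\<And>x. 0 < r x" "absolutely_continuous P Q"
  shows "absolutely_continuous (density P r) Q"
proof -
  have r0: "ennreal (r x) \<noteq> 0" for x
    using assms(2)[of x] by (auto simp: ennreal_eq_0_iff not_le)
  have "null_sets (density P r) = null_sets P"
  proof (intro set_eqI)
    fix A
    have "A \<in> null_sets (density P r) \<longleftrightarrow> A \<in> sets P \<and> (AE x in P. x \<notin> A)"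
      using assms(1) r0 by (subst null_sets_density_iff) auto
    also have "\<dots> \<longleftrightarrow> A \<in> null_sets P"
      using AE_iff_null_sets[of A P] by auto
    finally show "A \<in> null_sets (density P r) \<longleftrightarrow> A \<in> null_sets P" .
  qed
  then show ?thesis using assms(3) by (simp add: absolutely_continuous_def)
qed

lemma dominated_density:
  assumes "real_distribution (density P f)" "f \<in> borel_measurable P"
  shows "dominated P (density P f)"
  using assms absolutely_continuousI_density by (auto simp: dominated_def)

lemma dominated_tilted:
  assumes "real_distribution P" and "lam > 0"
  shows "dominated P (tilted P lam a)"
proof -
  interpret real_distribution P by fact
  show ?thesis
    using real_distribution_tilted[OF assms, of a] unfolding tilted_def
    by (intro dominated_density) auto
qed

text \<open>
  The chain rule for the tilted reference measure. Because \<open>ln (dT/dP)\<close> is affine in the indicator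
  of \<open>{..a}\<close>, its integral depends on \<open>Q\<close> only through the objective \<open>Q {..a}\<close>; this is what makes
  the exponential tilt the right candidate.
\<close>

lemma DKL_split_tilted:
  assumes "real_distribution P" and "lam > 0" and Q: "dominated P Q"
  shows "dominated (tilted P lam a) Q"
    and "DKL Q P = DKL Q (tilted P lam a)
           + ereal (- ln (tilt_Z P lam a) - measure Q {..a} / lam)"
proof -
  interpret P: real_distribution P by fact
  interpret Q: real_distribution Q using Q by (simp add: dominated_def)
  let ?r = "\<lambda>x. exp (- indicator {..a} x / lam) / tilt_Z P lam a"
  note Zp = tilt_Z_pos[OF assms(1,2), of a]
  have r_pos: "0 < ?r x" for x using Zp by simp
  have r_meas: "?r \<in> borel_measurable P" by measurable
  have ln_r: "ln (?r x) = - indicator {..a} x / lam - ln (tilt_Z P lam a)" for x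
    using Zp by (simp add: ln_div)
  show "dominated (tilted P lam a) Q"
    using Q absolutely_continuous_density_pos[OF r_meas r_pos, of Q]
    by (auto simp: dominated_def tilted_def)
  have int: "integrable Q (\<lambda>x. ln (?r x))"
    unfolding ln_r by (auto simp: Q.emeasure_eq_measure)
  have "(\<integral>x. ln (?r x) \<partial>Q) = - ln (tilt_Z P lam a) - measure Q {..a} / lam"
    unfolding ln_r by (subst Bochner_Integration.integral_diff)
      (auto simp: Q.emeasure_eq_measure Q.prob_space[unfolded Q.space_eq_univ])
  then show "DKL Q P = DKL Q (tilted P lam a)
      + ereal (- ln (tilt_Z P lam a) - measure Q {..a} / lam)"
    using DKL_chain[OF P.sigma_finite_measure_axioms Q.finite_measure_axioms _ _ r_meas r_pos int] Q
    by (auto simp: dominated_def tilted_def)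
qed

text \<open>The previous identity at \<open>Q = tilted P lam a\<close>, where the first summand vanishes.\<close>

lemma DKL_tilted:
  assumes "real_distribution P" and "lam > 0"
  shows "DKL (tilted P lam a) P
    = ereal (- ln (tilt_Z P lam a) - 1 / lam * cdf (tilted P lam a) a)"
  using DKL_split_tilted(2)[OF assms dominated_tilted[OF assms], of a a]
    DKL_refl[OF real_distribution_tilted[OF assms]]
  by (simp add: cdf_def)

lemma cdf_tilted:
  assumes "real_distribution P" and "lam > 0"
  shows "cdf (tilted P lam a) a = exp (- 1 / lam) * cdf P a / tilt_Z P lam a"
proof -
  interpret real_distribution P by fact
  note Zp = tilt_Z_pos[OF assms, of a]
  have "emeasure (tilted P lam a) {..a}
      = (\<integral>\<^sup>+x. ennreal (exp (- 1 / lam) / tilt_Z P lam a) * indicator {..a} x \<partial>P)"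
    unfolding tilted_def
    by (subst emeasure_density) (auto intro!: nn_integral_cong simp: indicator_def)
  also have "\<dots> = ennreal (exp (- 1 / lam) / tilt_Z P lam a * measure P {..a})"
    using Zp by (subst nn_integral_cmult_indicator)
      (auto simp: emeasure_eq_measure ennreal_mult[symmetric])
  finally show ?thesis
    using Zp by (simp add: cdf_def measure_def)
qed

section \<open>Lagrangian duality\<close>

text \<open>
  In \<open>Q {..a} + lam * (DKL Q P - \<epsilon>)\<close> the splitting of \<open>DKL Q P\<close> cancels the objective: only the
  divergence from the tilted measure and a constant remain.
\<close>

lemma lagrangian_gap:
  assumes "real_distribution P" and "lam > 0" and Q: "dominated P Q"
  shows "lagrangian P \<epsilon> a Q lam
    = lagrangian P \<epsilon> a (tilted P lam a) lam + ereal lam * DKL Q (tilted P lam a)"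
proof (cases "DKL Q (tilted P lam a)")
  case (real d)
  then show ?thesis
    using DKL_split_tilted(2)[OF assms, of a] DKL_tilted[OF assms(1,2), of a] assms(2)
    by (simp add: lagrangian_def cdf_def field_simps)
next
  case PInf
  then show ?thesis
    using DKL_split_tilted(2)[OF assms, of a] DKL_tilted[OF assms(1,2), of a] assms(2)
    by (simp add: lagrangian_def)
next
  case MInf
  then show ?thesis
    using DKL_gibbs(1)[OF real_distribution_tilted[OF assms(1,2)]
        DKL_split_tilted(1)[OF assms], of a] by simp
qed

lemma lagrangian_minimizer:
  assumes "real_distribution P" and "lam > 0" and Q: "dominated P Q"
  shows "lagrangian P \<epsilon> a (tilted P lam a) lam \<le> lagrangian P \<epsilon> a Q lam"
    and "lagrangian P \<epsilon> a Q lam = lagrangian P \<epsilon> a (tilted P lam a) lam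
      \<Longrightarrow> Q = tilted P lam a"
proof -
  note gibbs = DKL_gibbs[OF real_distribution_tilted[OF assms(1,2)]
      DKL_split_tilted(1)[OF assms], of a]
  obtain l where l: "lagrangian P \<epsilon> a (tilted P lam a) lam = ereal l"
    using DKL_tilted[OF assms(1,2), of a] by (simp add: lagrangian_def)
  show "lagrangian P \<epsilon> a (tilted P lam a) lam \<le> lagrangian P \<epsilon> a Q lam"
    unfolding lagrangian_gap[OF assms] l using gibbs assms(2)
    by (cases "DKL Q (tilted P lam a)") auto
  show "Q = tilted P lam a"
    if "lagrangian P \<epsilon> a Q lam = lagrangian P \<epsilon> a (tilted P lam a) lam"
    using that unfolding lagrangian_gap[OF assms] l using gibbs assms(2)
    by (cases "DKL Q (tilted P lam a)") (auto simp: zero_ereal_def)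
qed

text \<open>
  On the feasible set the penalty term is nonpositive, so the Lagrangian lies below the objective;
  at the tilted measure the two agree because the constraint is active. A minimiser of the
  Lagrangian therefore minimises the objective, and a second solution would also minimise the
  Lagrangian.
\<close>

lemma tilted_optimal:
  assumes "real_distribution P" and lam: "lam > 0"
    and active: "DKL (tilted P lam a) P = ereal \<epsilon>"
  shows "is_solution P \<epsilon> a (tilted P lam a)"
    and "is_solution P \<epsilon> a Q \<Longrightarrow> Q = tilted P lam a"
    and "lagrange_multiplier P \<epsilon> a (tilted P lam a) lam"
proof -
  let ?T = "tilted P lam a"
  have feas: "feasible P \<epsilon> ?T"
    using active dominated_tilted[OF assms(1,2)] by (simp add: feasible_def)
  have LT: "lagrangian P \<epsilon> a ?T lam = ereal (measure ?T {..a})"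
    using active by (simp add: lagrangian_def)
  have le: "lagrangian P \<epsilon> a Q lam \<le> ereal (measure Q {..a})" if "feasible P \<epsilon> Q" for Q
    using that lam by (cases "DKL Q P") (auto simp: feasible_def lagrangian_def mult_le_0_iff)
  have min: "measure ?T {..a} \<le> measure Q {..a}" if "feasible P \<epsilon> Q" for Q
  proof -
    have "ereal (measure ?T {..a}) \<le> lagrangian P \<epsilon> a Q lam"
      using lagrangian_minimizer(1)[OF assms(1,2), of Q \<epsilon> a] that LT by (simp add: feasible_def)
    also have "\<dots> \<le> ereal (measure Q {..a})" by (rule le) fact
    finally show ?thesis by simp
  qed
  show sol: "is_solution P \<epsilon> a ?T"
    using feas min by (auto simp: is_solution_def is_arg_min_def not_less)
  show "Q = ?T" if "is_solution P \<epsilon> a Q"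
  proof -
    have Q: "feasible P \<epsilon> Q" "measure Q {..a} \<le> measure ?T {..a}"
      using that feas by (auto simp: is_solution_def is_arg_min_def not_less)
    then have "lagrangian P \<epsilon> a Q lam \<le> lagrangian P \<epsilon> a ?T lam"
      using le[OF Q(1)] LT by (auto intro: order_trans)
    then show ?thesis
      using lagrangian_minimizer[OF assms(1,2), of Q \<epsilon> a] Q(1)
      by (auto simp: feasible_def intro: antisym)
  qed
  show "lagrange_multiplier P \<epsilon> a ?T lam"
    using feas lam active lagrangian_minimizer(1)[OF assms(1,2)] dominated_tilted[OF assms(1,2)]
    by (auto simp: lagrange_multiplier_def is_arg_min_def not_less)
qed

section \<open>The divergence as a function of the multiplier\<close>

text \<open>
  The divergence in the parameter \<open>u = exp (- 1 / lam)\<close>, where \<open>p\<close> stands for \<open>cdf P a\<close> and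
  \<open>1 - p + u * p\<close> is the normalising constant. This form makes sense at \<open>u = 1\<close>, which corresponds
  to \<open>lam = \<infinity>\<close>.
\<close>

definition tilt_divergence :: "real \<Rightarrow> real \<Rightarrow> real" where
  "tilt_divergence p u = u * ln u * p / (1 - p + u * p) - ln (1 - p + u * p)"

lemma DKL_tilted_eq_tilt_divergence:
  assumes "real_distribution P" and "lam > 0"
  shows "DKL (tilted P lam a) P = ereal (tilt_divergence (cdf P a) (exp (- 1 / lam)))"
proof -
  have "tilt_Z P lam a = 1 - cdf P a + exp (- 1 / lam) * cdf P a"
    by (simp add: tilt_Z_def algebra_simps)
  then show ?thesis
    using DKL_tilted[OF assms, of a] cdf_tilted[OF assms, of a]
    by (simp add: tilt_divergence_def)
qed

lemma continuous_on_DKL_tilted: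
  assumes "real_distribution P"
  shows "continuous_on {0<..} (\<lambda>lam. DKL (tilted P lam a) P)"
proof -
  have "continuous_on {0<..}
      (\<lambda>lam. ereal (- ln (tilt_Z P lam a) - 1 / lam * (exp (- 1 / lam) * cdf P a / tilt_Z P lam a)))"
    using tilt_Z_pos[OF assms, of _ a] unfolding tilt_Z_def
    by (intro continuous_on_ereal continuous_intros) force+
  then show ?thesis
    by (rule continuous_on_cong[THEN iffD1, rotated -1])
      (auto simp: DKL_tilted[OF assms] cdf_tilted[OF assms])
qed

context
  fixes p :: real
  assumes p: "0 < p" "p < 1"
begin

lemma continuous_on_tilt_divergence: "continuous_on {0<..1} (tilt_divergence p)"
proof -
  have "0 < 1 - p + u * p" if "u > 0" for u
    using p that by (simp add: add_pos_pos)
  then show ?thesis unfolding tilt_divergence_def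
    by (intro continuous_intros) force+
qed

lemma tilt_divergence_strict_decreasing:
  assumes "0 < u" "u < v" "v \<le> 1"
  shows "tilt_divergence p v < tilt_divergence p u"
proof (rule DERIV_neg_imp_decreasing_open[OF assms(2)])
  show "continuous_on {u..v} (tilt_divergence p)"
    by (rule continuous_on_subset[OF continuous_on_tilt_divergence]) (use assms in auto)
  fix x assume x: "u < x" "x < v"
  let ?Z = "1 - p + x * p"
  have Z: "0 < ?Z" using x assms p by (simp add: add_pos_pos)
  have "(tilt_divergence p has_real_derivative
      ((ln x + 1) * p * ?Z - x * ln x * p * p) / ?Z\<^sup>2 - p / ?Z) (at x)"
    unfolding tilt_divergence_def using Z x assms
    by (auto intro!: derivative_eq_intros simp: power2_eq_square)
  also have "((ln x + 1) * p * ?Z - x * ln x * p * p) / ?Z\<^sup>2 - p / ?Z = ln x * (p * (1 - p) / ?Z\<^sup>2)"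
    using Z by (simp add: divide_simps) (simp add: power2_eq_square algebra_simps)
  finally have "(tilt_divergence p has_real_derivative ln x * (p * (1 - p) / ?Z\<^sup>2)) (at x)" .
  moreover have "ln x * (p * (1 - p) / ?Z\<^sup>2) < 0"
    using x assms p Z by (intro mult_neg_pos) auto
  ultimately show "\<exists>y. (tilt_divergence p has_real_derivative y) (at x) \<and> y < 0" by blast
qed

lemma tilt_divergence_at_0: "(tilt_divergence p \<longlongrightarrow> - ln (1 - p)) (at_right 0)"
proof -
  have "((\<lambda>u::real. u * ln u) \<longlongrightarrow> 0) (at_right 0)" by real_asymp
  then have "((\<lambda>u. u * ln u * p / (1 - p + u * p) - ln (1 - p + u * p))
      \<longlongrightarrow> 0 * p / (1 - p + 0 * p) - ln (1 - p + 0 * p)) (at_right 0)"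
    using p by (intro tendsto_intros) auto
  then show ?thesis unfolding tilt_divergence_def by simp
qed

text \<open>
  The intermediate value theorem needs a closed interval, so the limit at 0 supplies a left
  endpoint where the divergence already exceeds the target; the right endpoint is \<open>u = 1\<close>, where
  the divergence is 0.
\<close>

lemma tilt_divergence_attains:
  assumes "0 < e" "e < - ln (1 - p)"
  shows "\<exists>u. 0 < u \<and> u < 1 \<and> tilt_divergence p u = e"
proof -
  have "eventually (\<lambda>u. e < tilt_divergence p u) (at_right 0)"
    using tilt_divergence_at_0 assms(2) by (rule order_tendstoD)
  moreover have "eventually (\<lambda>u::real. 0 < u \<and> u < 1) (at_right 0)"
    by (simp add: eventually_at_right_less eventually_at_right_field) (auto intro: exI[of _ 1])
  ultimately have "eventually (\<lambda>u. e < tilt_divergence p u \<and> 0 < u \<and> u < 1) (at_right 0)"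
    by eventually_elim auto
  then obtain u where u: "e < tilt_divergence p u" "0 < u" "u < 1"
    using eventually_happens'[OF trivial_limit_at_right_real] by blast
  have one: "tilt_divergence p 1 = 0" by (simp add: tilt_divergence_def)
  obtain v where "u \<le> v" "v \<le> 1" "tilt_divergence p v = e"
    using IVT2'[of "tilt_divergence p" 1 e u] u assms one
      continuous_on_subset[OF continuous_on_tilt_divergence, of "{u..1}"] by force
  then show ?thesis using u one assms(1)
    by (intro exI[of _ v]) (auto simp: less_le)
qed

end

lemma strict_antimono_DKL_tilted:
  assumes "real_distribution P" "0 < cdf P a" "cdf P a < 1"
  shows "strict_antimono_on {0<..} (\<lambda>lam. DKL (tilted P lam a) P)"
proof (rule monotone_onI)
  fix l m :: real assume lm: "l \<in> {0<..}" "m \<in> {0<..}" "l < m"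
  then have "exp (- 1 / l) < exp (- 1 / m)" "exp (- 1 / m) \<le> 1"
    by (auto simp: field_simps)
  then show "DKL (tilted P m a) P < DKL (tilted P l a) P"
    using lm tilt_divergence_strict_decreasing[OF assms(2,3)]
    by (simp add: DKL_tilted_eq_tilt_divergence[OF assms(1)])
qed

lemma ex1_DKL_tilted:
  assumes "real_distribution P" "0 < cdf P a" "cdf P a < 1" "0 < e" "e < - ln (1 - cdf P a)"
  shows "\<exists>!lam. lam \<in> {0<..} \<and> DKL (tilted P lam a) P = ereal e"
proof -
  obtain u where u: "0 < u" "u < 1" "tilt_divergence (cdf P a) u = e"
    using tilt_divergence_attains[OF assms(2-5)] by blast
  \<comment> \<open>the inverse of the substitution \<open>u = exp (- 1 / lam)\<close>\<close>
  define lam where "lam = - 1 / ln u"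
  have lam: "lam > 0" "exp (- 1 / lam) = u"
    using u by (auto simp: lam_def divide_neg_neg)
  have "DKL (tilted P lam a) P = ereal e"
    using DKL_tilted_eq_tilt_divergence[OF assms(1) lam(1)] lam u by simp
  moreover have "inj_on (\<lambda>lam. DKL (tilted P lam a) P) {0<..}"
    using strict_antimono_DKL_tilted[OF assms(1-3)] by (simp add: strict_antimono_iff_antimono)
  ultimately show ?thesis using lam(1)
    by (intro ex1I[of _ lam]) (auto simp: inj_on_def)
qed

section \<open>Existence of a solution for every level of the constraint\<close>

lemma is_solution_of_null:
  assumes "feasible P \<epsilon> Q" "measure Q {..a} = 0"
  shows "is_solution P \<epsilon> a Q"
  using assms by (auto simp: is_solution_def is_arg_min_def not_less)

lemma feasible_self:
  assumes "real_distribution P" "0 \<le> \<epsilon>"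
  shows "feasible P \<epsilon> P"
  using assms DKL_refl[OF assms(1)]
  by (auto simp: feasible_def dominated_def absolutely_continuous_def)

text \<open>All measures dominated by \<open>P\<close> then give \<open>{..a}\<close> full mass, so the objective is constant.\<close>

lemma is_solution_self_of_cdf_1:
  assumes "real_distribution P" "0 \<le> \<epsilon>" "cdf P a = 1"
  shows "is_solution P \<epsilon> a P"
proof -
  interpret P: real_distribution P by fact
  have "measure Q {..a} = 1" if "dominated P Q" for Q
  proof -
    interpret Q: real_distribution Q using that by (simp add: dominated_def)
    have "AE x in P. x \<in> {..a}"
      using assms(3) by (subst P.AE_in_set_eq_1) (auto simp: cdf_def)
    then have "AE x in Q. x \<in> {..a}"
      using that by (intro absolutely_continuous_AE[of Q P]) (auto simp: dominated_def)
    then show ?thesis by (subst (asm) Q.AE_in_set_eq_1) auto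
  qed
  moreover have "measure P {..a} = 1" using assms(3) by (simp add: cdf_def)
  ultimately show ?thesis using feasible_self[OF assms(1,2)]
    by (auto simp: is_solution_def is_arg_min_def feasible_def)
qed

text \<open>
  The witness is \<open>P\<close> conditioned on \<open>{a<..}\<close>. Its density is constant where it does not vanish, so
  its divergence is \<open>- ln (1 - cdf P a)\<close>.
\<close>

lemma ex_feasible_null:
  assumes "real_distribution P" "cdf P a < 1" "- ln (1 - cdf P a) \<le> \<epsilon>"
  shows "\<exists>Q. feasible P \<epsilon> Q \<and> measure Q {..a} = 0"
proof -
  interpret P: real_distribution P by fact
  let ?c = "1 - cdf P a"
  let ?f = "\<lambda>x. indicator {a<..} x / ?c"
  define Q where "Q = density P ?f"
  have c: "0 < ?c" using assms(2) by simp
  have compl: "measure P {a<..} = ?c"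
  proof -
    have "{a<..} = UNIV - {..a}" by auto
    then show ?thesis
      using P.prob_compl[of "{..a}"] by (simp add: cdf_def P.space_eq_univ)
  qed
  have em: "emeasure Q A = ennreal (measure P (A \<inter> {a<..}) / ?c)" if "A \<in> sets borel" for A
  proof -
    have "emeasure Q A = (\<integral>\<^sup>+x. ennreal (1 / ?c) * indicator (A \<inter> {a<..}) x \<partial>P)"
      using that unfolding Q_def
      by (subst emeasure_density) (auto intro!: nn_integral_cong simp: indicator_def)
    then show ?thesis
      using that c by (simp add: nn_integral_cmult_indicator P.emeasure_eq_measure
          ennreal_mult[symmetric])
  qed
  have "real_distribution Q"
    using em[of UNIV] c compl
    by (auto simp: real_distribution_def real_distribution_axioms_def Q_def intro!: prob_spaceI)
  then interpret Q: real_distribution Q .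
  have dom: "dominated P Q"
    using \<open>real_distribution Q\<close> unfolding Q_def by (intro dominated_density) auto
  have null: "measure Q {..a} = 0"
  proof -
    have "{..a} \<inter> {a<..} = {}" by auto
    then show ?thesis using em[of "{..a}"] by (simp add: measure_def)
  qed
  have "AE x in Q. entropy_density (exp 1) P Q x = ln (?f x)"
    unfolding Q_def by (rule entropy_density_density)
      (use c P.sigma_finite_measure_axioms in auto)
  moreover have "AE x in Q. x \<in> {a<..}"
    using em[of "{a<..}"] c compl by (subst Q.AE_in_set_eq_1) (auto simp: measure_def)
  ultimately have ed: "AE x in Q. entropy_density (exp 1) P Q x = - ln ?c"
    by eventually_elim (use c in \<open>simp add: ln_div\<close>)
  have meas: "entropy_density (exp 1) P Q \<in> borel_measurable Q"
    using measurable_entropy_density[of "exp 1" P Q] unfolding Q_def by simp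
  have "integrable Q (entropy_density (exp 1) P Q)"
    using ed meas by (subst integrable_cong_AE[of _ _ "\<lambda>_. - ln ?c"]) auto
  moreover have "KL_divergence (exp 1) P Q = (\<integral>x. - ln ?c \<partial>Q)"
    unfolding KL_divergence_def by (rule integral_cong_AE) (use ed meas in auto)
  ultimately have "DKL Q P = ereal (- ln ?c)"
    by (simp add: DKL_def Q.prob_space[unfolded Q.space_eq_univ])
  then show ?thesis using dom null assms(3) by (auto simp: feasible_def)
qed

lemma ex_solution:
  assumes P: "real_distribution P" and "0 < \<epsilon>"
  shows "\<exists>Q. is_solution P \<epsilon> a Q"
proof -
  interpret real_distribution P by fact
  have F: "0 \<le> cdf P a" "cdf P a \<le> 1" by (simp_all add: cdf_nonneg cdf_bounded_prob)
  consider "cdf P a = 0" | "cdf P a = 1" | "0 < cdf P a" "cdf P a < 1" "\<epsilon> < - ln (1 - cdf P a)"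
    | "cdf P a < 1" "- ln (1 - cdf P a) \<le> \<epsilon>"
    using F by force
  then show ?thesis
  proof cases
    case 1
    then show ?thesis
      using is_solution_of_null[OF feasible_self[OF P], of \<epsilon> a] assms(2)
      by (auto simp: cdf_def)
  next
    case 2
    then show ?thesis using is_solution_self_of_cdf_1[OF P, of \<epsilon> a] assms(2) by auto
  next
    case 3
    then show ?thesis using ex1_DKL_tilted[OF P 3(1,2) assms(2) 3(3)] tilted_optimal(1)[OF P] by blast
  next
    case 4
    then show ?thesis using ex_feasible_null[OF P] is_solution_of_null by blast
  qed
qed

section \<open>The optimal measure\<close>

theorem proposition2p2:
  fixes P :: "real measure" and \<epsilon> a :: real
  assumes "real_distribution P"
    and "\<epsilon> > 0"
  shows
    "((\<exists>Q. is_solution P \<epsilon> a Q) \<and>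
      (0 < cdf P a \<and> cdf P a < 1 \<and> \<epsilon> < - ln (1 - cdf P a) \<longrightarrow>
         (\<exists>!Q. is_solution P \<epsilon> a Q) \<and>
         (\<exists>lam>0. is_solution P \<epsilon> a (tilted P lam a) \<and>
                  lagrange_multiplier P \<epsilon> a (tilted P lam a) lam)))
     \<and>
     (\<forall>lam>0.
        cdf (tilted P lam a) a = exp (- 1 / lam) * cdf P a / tilt_Z P lam a \<and>
        DKL (tilted P lam a) P
          = ereal (- ln (tilt_Z P lam a) - 1 / lam * cdf (tilted P lam a) a))
     \<and>
     (continuous_on {0<..} (\<lambda>lam. DKL (tilted P lam a) P) \<and>
      (0 < cdf P a \<and> cdf P a < 1 \<longrightarrow>
         strict_antimono_on {0<..} (\<lambda>lam. DKL (tilted P lam a) P) \<and>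
         (\<forall>\<epsilon>'>0. \<epsilon>' < - ln (1 - cdf P a) \<longrightarrow>
            (\<exists>!lam. lam \<in> {0<..} \<and> DKL (tilted P lam a) P = ereal \<epsilon>'))))"
proof (intro conjI impI allI)
  show "\<exists>Q. is_solution P \<epsilon> a Q"
    by (rule ex_solution) fact+
next
  assume "0 < cdf P a \<and> cdf P a < 1 \<and> \<epsilon> < - ln (1 - cdf P a)"
  then obtain lam where lam: "lam > 0" "DKL (tilted P lam a) P = ereal \<epsilon>"
    using ex1_DKL_tilted[OF assms(1) _ _ assms(2), of a] by auto
  note opt = tilted_optimal[OF assms(1) lam]
  show "\<exists>!Q. is_solution P \<epsilon> a Q"
    using opt by blast
  show "\<exists>lam>0. is_solution P \<epsilon> a (tilted P lam a) \<and>
      lagrange_multiplier P \<epsilon> a (tilted P lam a) lam"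
    using opt lam by blast
next
  fix lam :: real assume "lam > 0"
  then show "cdf (tilted P lam a) a = exp (- 1 / lam) * cdf P a / tilt_Z P lam a"
    and "DKL (tilted P lam a) P
      = ereal (- ln (tilt_Z P lam a) - 1 / lam * cdf (tilted P lam a) a)"
    using cdf_tilted DKL_tilted assms(1) by blast+
next
  show "continuous_on {0<..} (\<lambda>lam. DKL (tilted P lam a) P)"
    by (rule continuous_on_DKL_tilted) fact
next
  assume "0 < cdf P a \<and> cdf P a < 1"
  then show "strict_antimono_on {0<..} (\<lambda>lam. DKL (tilted P lam a) P)"
    and "\<And>\<epsilon>'. 0 < \<epsilon>' \<Longrightarrow> \<epsilon>' < - ln (1 - cdf P a)
      \<Longrightarrow> \<exists>!lam. lam \<in> {0<..} \<and> DKL (tilted P lam a) P = ereal \<epsilon>'"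
    using strict_antimono_DKL_tilted ex1_DKL_tilted assms(1) by blast+
qed

end
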